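(* Let $n\ge 1$ and let $S:\{0,1\}^n\to\{0,1\}^n$ be a Boolean model on $X=\{0,1\}^n$. If the regulatory graph $\mathcal{RG}(S)$ does not contain any circuit, then the asynchronous dynamics defined by $S$ is simple. Moreover, for any $x\in X$, there exists in the asynchronous state transition graph of $S$ a path of length at most $n$ from $x$ to the single fixed point of $S$.
   Context: A Boolean model is a map $S=(S_1,\dots,S_n): X=\{0,1\}^n\to X$, with $n$ an integer $>0$; elements of $X$ are called states. For $x\in X$ and $i\in\{1,\dots,n\}$, $\overline{x}^{i}$ denotes the state obtained from $x$ by switching ($0\leftrightarrow 1$) the $i$-th coordinate. Regulatory graph: $\mathcal{RG}(S)$ is the directed graph with vertices $g_1,\dots,g_n$ and an edge from $g_i$ to $g_j$ (possibly $i=j$) if and only if there exists $x\in X$ such that $S_j(x)\neq S_j(\overline{x}^{i})$. A circuit is a directed cycle of this graph (a loop $g_i\to g_i$ counts as a circuit). Updating set: $Upd_S(x)=\{i\in\{1,\dots,n\} : S_i(x)\neq x_i\}$. Asynchronous dynamics: its state transition graph is the directed graph with vertex set $X$ whose edges with origin $x$ are exactly those going from $x$ to $\overline{x}^{i}$, where $i$ is any element of $Upd_S(x)$. The trajectories of the dynamics are the paths of this graph. Simple: a dynamics (and its state transition graph) is called simple if the graph has only one attractor, i.e. only one terminal strongly connected component (one with no edge leaving it), and this attractor is reduced to a single state. By a known theorem of Robert, if $\mathcal{RG}(S)$ contains no circuit then $S$ has exactly one fixed point; this is "the single fixed point of $S$". *)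

theory Defs
  imports "HOL-Analysis.Finite_Cartesian_Product" "Graph_Theory.Graph_Theory"
begin

text \<open>
  The coordinates \<open>1, \<dots>, n\<close> are the elements of an arbitrary finite type \<open>'n\<close> with
  \<open>CARD('n) = n\<close> (so \<open>n \<ge> 1\<close>, types being nonempty), and \<open>0\<close>, \<open>1\<close> are \<open>False\<close>, \<open>True\<close>.
\<close>

type_synonym 'n state = "bool ^ 'n"

type_synonym 'n boolean_model = "'n state \<Rightarrow> 'n state"

definition switch :: "'n::finite \<Rightarrow> 'n state \<Rightarrow> 'n state" where
  "switch i x = (\<chi> j. if j = i then \<not> x $ j else x $ j)"

definition regulatory_graph :: "'n::finite boolean_model \<Rightarrow> ('n, 'n \<times> 'n) pre_digraph" where
  "regulatory_graph S =
     with_proj \<lparr> pverts = UNIV, parcs = {(i, j). \<exists>x. S x $ j \<noteq> S (switch i x) $ j} \<rparr>"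

definition updating_set :: "'n::finite boolean_model \<Rightarrow> 'n state \<Rightarrow> 'n set" where
  "updating_set S x = {i. S x $ i \<noteq> x $ i}"

definition async_graph ::
  "'n::finite boolean_model \<Rightarrow> ('n state, 'n state \<times> 'n state) pre_digraph" where
  "async_graph S =
     with_proj \<lparr> pverts = UNIV, parcs = {(x, switch i x) | x i. i \<in> updating_set S x} \<rparr>"

definition attractors :: "('a, 'b) pre_digraph \<Rightarrow> ('a, 'b) pre_digraph set" where
  "attractors G = {H \<in> pre_digraph.sccs G.
     \<forall>e \<in> arcs G. tail G e \<in> verts H \<longrightarrow> head G e \<in> verts H}"

definition simple_dynamics :: "('a, 'b) pre_digraph \<Rightarrow> bool" where
  "simple_dynamics G \<longleftrightarrow> (\<exists>H x. attractors G = {H} \<and> verts H = {x})"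

end

theory Submission
  imports Defs
begin

text \<open>
  Since the regulatory graph is acyclic, the coordinates can be updated one at a time, each after
  all its regulators. A coordinate that agrees with \<open>S\<close> once its regulators have been treated never
  needs to be updated again, so this gives an asynchronous path with at most one step per
  coordinate from any state to a fixed point. Two fixed points agree coordinate by coordinate, by
  well-founded induction along the regulatory graph. Finally, a vertex without outgoing arcs that
  is reachable from every vertex is the only attractor.
\<close>

lemma wf_digraph_with_proj_UNIV: "wf_digraph (with_proj \<lparr>pverts = UNIV, parcs = A\<rparr>)"
  by unfold_locales auto

text \<open>A nonempty walk from a vertex back to itself is closed, and every closed walk contains a
  cycle.\<close>

lemma (in wf_digraph) acyclic_arcs_ends:
  assumes "\<nexists>c. cycle c"
  shows "acyclic (arcs_ends G)"
proof (rule acyclicI, intro allI notI)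
  fix u assume "u \<rightarrow>\<^sup>+ u"
  then obtain p where "awalk u p u" "p \<noteq> []"
    by (auto simp: reachable1_awalk)
  then have "closed_w p"
    by (auto simp: closed_w_def)
  with assms closed_w_imp_cycle show False by blast
qed

lemma (in wf_digraph) reachable_from_sink:
  assumes "u \<rightarrow>\<^sup>* v" and "\<forall>e \<in> arcs G. tail G e \<noteq> u"
  shows "v = u"
  using assms by (induct rule: converse_reachable_induct) auto

lemma (in wf_digraph) reachable_sink_imp_simple:
  assumes z: "z \<in> verts G"
    and sink: "\<forall>e \<in> arcs G. tail G e \<noteq> z"
    and reach: "\<forall>x \<in> verts G. x \<rightarrow>\<^sup>* z"
  shows "simple_dynamics G"
proof -
  \<comment> \<open>Strong connectivity makes every vertex of \<open>H\<close> reachable from the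
    sink \<open>z\<close>. This serves twice: to identify an arbitrary attractor and to show that
    \<open>{z}\<close> is maximal.\<close>
  have only_z: "verts H = {z}"
    if H: "subgraph H G" "strongly_connected H" "z \<in> verts H" for H
  proof -
    have "v = z" if "v \<in> verts H" for v
    proof -
      have "z \<rightarrow>\<^sup>*\<^bsub>H\<^esub> v"
        using H that by (auto simp: strongly_connected_def)
      then have "z \<rightarrow>\<^sup>* v"
        using H(1) reachable_mono by blast
      then show ?thesis
        using sink reachable_from_sink by blast
    qed
    with H(3) show ?thesis by blast
  qed
  have "attractors G = {G \<restriction> {z}}"
  proof (intro equalityI subsetI)
    fix H assume "H \<in> attractors G"
    then have ind: "induced_subgraph H G" and sc: "strongly_connected H"
      and closed: "\<And>e. e \<in> arcs G \<Longrightarrow> tail G e \<in> verts H \<Longrightarrow> head G e \<in> verts H"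
      by (auto simp: attractors_def sccs_def)
    from sc obtain x where x: "x \<in> verts H"
      by (auto simp: strongly_connected_def)
    have sub: "subgraph H G"
      using ind by (simp add: induced_subgraph_def)
    then have "x \<rightarrow>\<^sup>* z"
      using x reach by (auto simp: subgraph_def)
    then have "z \<in> verts H"
      \<comment> \<open>No arc leaves an attractor, so a path starting in \<open>H\<close> stays in
        \<open>H\<close> up to its end \<open>z\<close>.\<close>
      using x by (induct rule: converse_reachable_induct) (auto elim!: reachableE dest: closed)
    then have "verts H = {z}"
      using only_z sub sc by blast
    then show "H \<in> {G \<restriction> {z}}"
      \<comment> \<open>An induced subgraph is determined by its vertex set.\<close>
      using ind by (auto simp: induced_subgraph_def subgraph_def compatible_def induce_subgraph_def)
  next
    fix H assume "H \<in> {G \<restriction> {z}}"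
    then have H: "H = G \<restriction> {z}" by simp
    have ind: "induced_subgraph H G"
      unfolding H using z by (intro induced_induce) auto
    then have "wf_digraph H"
      by (auto simp: induced_subgraph_def subgraph_def)
    then have "strongly_connected H"
      by (auto simp: strongly_connected_def H wf_digraph.reachable_refl)
    moreover have "verts H' = {z}"
      if "induced_subgraph H' G" "strongly_connected H'" "verts H \<subset> verts H'" for H'
      using that only_z[of H'] by (auto simp: H induced_subgraph_def)
    ultimately have "H \<in> sccs"
      using ind by (auto simp: sccs_def H)
    with sink show "H \<in> attractors G"
      by (auto simp: attractors_def H)
  qed
  then show ?thesis
    unfolding simple_dynamics_def by auto
qed

abbreviation regulates :: "'n::finite boolean_model \<Rightarrow> ('n \<times> 'n) set" where
  "regulates S \<equiv> arcs_ends (regulatory_graph S)"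

lemma regulates_iff: "(i, j) \<in> regulates S \<longleftrightarrow> (\<exists>x. S x $ j \<noteq> S (switch i x) $ j)"
  by (simp add: regulatory_graph_def)

lemma switch_nth: "switch i x $ j = (if j = i then \<not> x $ j else x $ j)"
  by (simp add: switch_def)

text \<open>Turn \<open>x\<close> into \<open>y\<close> by switching the differing coordinates one
  at a time. None of them regulates \<open>j\<close>, so no switch changes component
  \<open>j\<close> of \<open>S\<close>. The induction is on the Hamming distance.\<close>

lemma depends_only_on_regulators:
  assumes "\<And>i. (i, j) \<in> regulates S \<Longrightarrow> x $ i = y $ i"
  shows "S x $ j = S y $ j"
  using assms
proof (induction "card {i. x $ i \<noteq> y $ i}" arbitrary: x rule: less_induct)
  case less
  show ?case
  proof (cases "x = y")
    case False
    then obtain i where i: "x $ i \<noteq> y $ i"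
      by (auto simp: vec_eq_iff)
    have "{k. switch i x $ k \<noteq> y $ k} \<subset> {k. x $ k \<noteq> y $ k}"
      using i by (auto simp: switch_nth split: if_splits)
    then have "card {k. switch i x $ k \<noteq> y $ k} < card {k. x $ k \<noteq> y $ k}"
      by (simp add: psubset_card_mono)
    moreover have "switch i x $ k = y $ k" if "(k, j) \<in> regulates S" for k
      using less.prems[OF that] i by (auto simp: switch_nth)
    ultimately have "S (switch i x) $ j = S y $ j"
      by (rule less.hyps)
    moreover have "S x $ j = S (switch i x) $ j"
      using less.prems i by (auto simp: regulates_iff)
    ultimately show ?thesis by simp
  qed simp
qed

lemma fixed_point_unique:
  assumes wf: "wf (regulates S)" and "S x = x" "S y = y"
  shows "x = y"
proof -
  have "x $ j = y $ j" for j
    using wf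
  proof (induction j rule: wf_induct_rule)
    case (less j)
    then have "S x $ j = S y $ j"
      by (rule depends_only_on_regulators)
    then show ?case
      using assms by simp
  qed
  then show ?thesis
    by (simp add: vec_eq_iff)
qed

lemma wf_async_graph: "wf_digraph (async_graph S)"
  unfolding async_graph_def by (rule wf_digraph_with_proj_UNIV)

text \<open>\<open>A\<close> collects the coordinates already treated: it contains the regulators of
  its members, and \<open>x\<close> agrees with \<open>S\<close> on it. Each round adds one
  coordinate to \<open>A\<close> at the cost of at most one arc, hence the bound by the number of
  coordinates left.\<close>

lemma exists_path_to_fixed_point:
  fixes S :: "'n::finite boolean_model"
  assumes wf: "wf (regulates S)"
    and down: "\<And>i j. (i, j) \<in> regulates S \<Longrightarrow> j \<in> A \<Longrightarrow> i \<in> A"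
    and settled: "\<And>i. i \<in> A \<Longrightarrow> S x $ i = x $ i"
  shows "\<exists>p z. pre_digraph.awalk (async_graph S) x p z \<and> S z = z \<and> length p \<le> card (- A)"
  using down settled
proof (induction "card (- A)" arbitrary: A x rule: less_induct)
  case less
  interpret wf_digraph "async_graph S" by (rule wf_async_graph)
  have verts: "v \<in> verts (async_graph S)" for v
    by (simp add: async_graph_def)
  show ?case
  proof (cases "A = UNIV")
    case True
    then have "S x = x"
      using less.prems(2) by (simp add: vec_eq_iff)
    then have "awalk x [] x \<and> S x = x \<and> length [] \<le> card (- A)"
      using verts by (simp add: awalk_Nil_iff)
    then show ?thesis by blast
  next
    case False
    \<comment> \<open>The next coordinate is a minimal one outside \<open>A\<close>, so all its
      regulators are treated.\<close>
    then obtain j where j: "j \<notin> A" and min: "\<And>i. (i, j) \<in> regulates S \<Longrightarrow> i \<in> A"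
      using wfE_min'[OF wf, of "- A"] by auto
    let ?A' = "insert j A"
    have "- A = insert j (- ?A')" "j \<notin> - ?A'"
      using j by auto
    then have card: "card (- A) = Suc (card (- ?A'))"
      by (metis card_insert_disjoint finite)
    have down': "i \<in> ?A'" if "(i, k) \<in> regulates S" "k \<in> ?A'" for i k
      using that min less.prems(1) by blast
    show ?thesis
    proof (cases "S x $ j = x $ j")
      case True
      then have "S x $ k = x $ k" if "k \<in> ?A'" for k
        using that less.prems(2) by blast
      then have "\<exists>p z. awalk x p z \<and> S z = z \<and> length p \<le> card (- ?A')"
        using less.hyps[of ?A' x] card down' by (metis lessI)
      then show ?thesis
        using card by (metis le_SucI)
    next
      case False
      \<comment> \<open>If \<open>j\<close> regulated a member of \<open>A\<close>, or itself, it
        would lie in \<open>A\<close>. Hence switching \<open>j\<close> changes no component of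
        \<open>S\<close> on \<open>?A'\<close>.\<close>
      have "(j, k) \<notin> regulates S" if "k \<in> ?A'" for k
        using that j min less.prems(1) by blast
      then have "S (switch j x) $ k = S x $ k" if "k \<in> ?A'" for k
        using that unfolding regulates_iff by metis
      \<comment> \<open>At \<open>j\<close> itself the values are Boolean: the one differing from
        \<open>x $ j\<close> is its negation.\<close>
      then have "S (switch j x) $ k = switch j x $ k" if "k \<in> ?A'" for k
        using that False less.prems(2) j by (auto simp: switch_nth)
      then obtain p z where p: "awalk (switch j x) p z" "S z = z" "length p \<le> card (- ?A')"
        using less.hyps[of ?A' "switch j x"] card down' by (metis lessI)
      have "tail (async_graph S) = fst" "head (async_graph S) = snd"
        by (simp_all add: async_graph_def)
      moreover have "(x, switch j x) \<in> arcs (async_graph S)"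
        using False by (auto simp: async_graph_def updating_set_def)
      ultimately have "awalk x ((x, switch j x) # p) z"
        using p(1) by (simp add: awalk_Cons_iff)
      then show ?thesis
        using p card by (intro exI[of _ "(x, switch j x) # p"] exI[of _ z]) simp
    qed
  qed
qed

theorem theorem3:
  fixes S :: "'n::finite boolean_model"
  assumes no_circuit: "\<nexists>c. pre_digraph.cycle (regulatory_graph S) c"
  shows "simple_dynamics (async_graph S) \<and>
    (\<exists>z. {y. S y = y} = {z} \<and>
      (\<forall>x. \<exists>p. pre_digraph.awalk (async_graph S) x p z \<and> length p \<le> CARD('n)))"
proof -
  interpret wf_digraph "async_graph S" by (rule wf_async_graph)
  have "acyclic (regulates S)"
    using no_circuit
    by (intro wf_digraph.acyclic_arcs_ends)
      (auto simp: regulatory_graph_def intro: wf_digraph_with_proj_UNIV)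
  then have wf: "wf (regulates S)"
    by (intro finite_acyclic_wf) simp
  have path: "\<exists>p z. awalk x p z \<and> S z = z \<and> length p \<le> CARD('n)" for x
    \<comment> \<open>With nothing treated yet, both conditions on \<open>A\<close> are vacuous and
      its complement has \<open>CARD('n)\<close> elements.\<close>
    using exists_path_to_fixed_point[OF wf, of "{}" x] by simp
  then obtain z where z: "S z = z" by blast
  have fixed: "{y. S y = y} = {z}"
    using fixed_point_unique[OF wf] z by auto
  \<comment> \<open>The fixed point reached could a priori depend on \<open>x\<close>; uniqueness
    identifies it with \<open>z\<close>.\<close>
  have to_z: "\<exists>p. awalk x p z \<and> length p \<le> CARD('n)" for x
    using path[of x] fixed_point_unique[OF wf _ z] by metis
  have "simple_dynamics (async_graph S)"
  proof (rule reachable_sink_imp_simple)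
    show "z \<in> verts (async_graph S)"
      by (simp add: async_graph_def)
    show "\<forall>e \<in> arcs (async_graph S). tail (async_graph S) e \<noteq> z"
      using z by (auto simp: async_graph_def updating_set_def)
    show "\<forall>x \<in> verts (async_graph S). x \<rightarrow>\<^sup>*\<^bsub>async_graph S\<^esub> z"
      using to_z by (auto simp: reachable_awalk)
  qed
  with fixed to_z show ?thesis by blast
qed

end
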